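(* For every integer $k\ge 0$, $|I_k(132,231)|$ is equal to the number of partitions of $k$ into distinct parts.
   Context: A permutation of length $n$ is a word $\pi=\pi_1\cdots\pi_n$ containing each of $1,\dots,n$ exactly once. The sum of permutations $\rho=\rho_1\cdots\rho_n$ and $\tau=\tau_1\cdots\tau_m$ is the permutation $\rho\oplus\tau=\rho_1\cdots\rho_n(n+\tau_1)\cdots(n+\tau_m)$ of length $n+m$. A permutation is decomposable if it equals $\rho\oplus\tau$ for some non-empty permutations $\rho,\tau$; a non-empty permutation that is not decomposable is indecomposable. An inversion of $\pi$ is a pair $(i,j)$ with $i<j$ and $\pi_i>\pi_j$. A permutation $\pi$ contains a permutation (pattern) $\tau=\tau_1\cdots\tau_m$ if there are indices $i_1<\dots<i_m$ such that $\pi_{i_1},\dots,\pi_{i_m}$ is order-isomorphic to $\tau_1,\dots,\tau_m$; otherwise $\pi$ avoids $\tau$. $I_k(\tau_1,\dots,\tau_r)$ denotes the (finite) set of all indecomposable permutations, of any length, with exactly $k$ inversions that avoid all of $\tau_1,\dots,\tau_r$. *)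

theory Defs
  imports "HOL-Combinatorics.Multiset_Permutations"
begin

text \<open>
  Permutations are words in one-line notation; list positions are counted from \<open>0\<close>, while the
  entries of a permutation of length \<open>n\<close> are \<open>1, \<dots>, n\<close>.
\<close>

definition is_perm :: "nat list \<Rightarrow> bool" where
  "is_perm p \<longleftrightarrow> p \<in> permutations_of_set {1..length p}"

definition perm_sum :: "nat list \<Rightarrow> nat list \<Rightarrow> nat list" where
  "perm_sum r t = r @ map (\<lambda>x. length r + x) t"

definition decomposable :: "nat list \<Rightarrow> bool" where
  "decomposable p \<longleftrightarrow>
     (\<exists>r t. is_perm r \<and> is_perm t \<and> r \<noteq> [] \<and> t \<noteq> [] \<and> p = perm_sum r t)"

definition indecomposable :: "nat list \<Rightarrow> bool" where
  "indecomposable p \<longleftrightarrow> is_perm p \<and> p \<noteq> [] \<and> \<not> decomposable p"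

definition inversions :: "nat list \<Rightarrow> (nat \<times> nat) set" where
  "inversions p = {(i, j). i < j \<and> j < length p \<and> p ! i > p ! j}"

definition contains_pattern :: "nat list \<Rightarrow> nat list \<Rightarrow> bool" where
  "contains_pattern p t \<longleftrightarrow>
     (\<exists>f. strict_mono_on {..<length t} f \<and> f ` {..<length t} \<subseteq> {..<length p} \<and>
          (\<forall>a<length t. \<forall>b<length t. p ! f a < p ! f b \<longleftrightarrow> t ! a < t ! b))"

definition avoids :: "nat list \<Rightarrow> nat list \<Rightarrow> bool" where
  "avoids p t \<longleftrightarrow> \<not> contains_pattern p t"

definition indecomposable_avoiders :: "nat \<Rightarrow> nat list set \<Rightarrow> nat list set" where
  "indecomposable_avoiders k T =
     {p. indecomposable p \<and> card (inversions p) = k \<and> (\<forall>t\<in>T. avoids p t)}"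

definition partitions :: "nat \<Rightarrow> nat multiset set" where
  "partitions k = {N. 0 \<notin># N \<and> sum_mset N = k}"

definition distinct_parts :: "nat multiset \<Rightarrow> bool" where
  "distinct_parts N \<longleftrightarrow> (\<forall>x. count N x \<le> 1)"

end

theory Submission
  imports Defs
begin

text \<open>
  A permutation avoids both \<open>132\<close> and \<open>231\<close> iff no entry has smaller entries on both of its sides,
  that is, iff it is a valley: a decreasing word followed by an increasing one.  With the entry \<open>1\<close>
  counted to the increasing part, a valley of length \<open>n\<close> is determined by the set
  \<open>D \<subseteq> {2..n}\<close> of the entries to the left of \<open>1\<close>.

  An entry \<open>x \<in> D\<close> precedes all smaller entries, and an entry of the increasing part
  precedes none of them, so the valley has \<open>\<Sum>x\<in>D. x - 1\<close> inversions
  (\<open>card_inversions_valley\<close>).  The maximal entry \<open>n\<close> of a valley is at one of its two ends.  If it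
  comes last and \<open>n > 1\<close>, it splits off as a summand of length \<open>1\<close>; if it comes first, the
  permutation is indecomposable.  So the indecomposable valleys are those that start with \<open>n\<close>;
  for them \<open>n\<close> is the maximum of \<open>D \<union> {1}\<close>, and \<open>D\<close> may be any finite set of integers
  \<open>\<ge> 2\<close> (\<open>bij_betw_valley_word\<close>).  Decreasing all elements of \<open>D\<close> by one gives the parts of a
  partition of the number of inversions into distinct parts.
\<close>

section \<open>The patterns 132 and 231\<close>

lemma is_perm_iff: "is_perm p \<longleftrightarrow> distinct p \<and> set p = {1..length p}"
  by (auto simp: is_perm_def permutations_of_set_def)

lemma contains_pattern_132_iff:
  "contains_pattern p [1, 3, 2] \<longleftrightarrow>
     (\<exists>i j l. i < j \<and> j < l \<and> l < length p \<and> p ! i < p ! l \<and> p ! l < p ! j)"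
proof
  assume "contains_pattern p [1, 3, 2]"
  then obtain f where f: "strict_mono_on {..<3::nat} f" "f ` {..<3} \<subseteq> {..<length p}"
    "\<And>a b. a < 3 \<Longrightarrow> b < 3 \<Longrightarrow> p ! f a < p ! f b \<longleftrightarrow> [1, 3, 2::nat] ! a < [1, 3, 2] ! b"
    by (auto simp: contains_pattern_def numeral_3_eq_3)
  have "f 0 < f 1" "f 1 < f 2" "f 2 < length p"
    using f(1,2) by (auto simp: strict_mono_on_def image_subset_iff)
  moreover have "p ! f 0 < p ! f 2" "p ! f 2 < p ! f 1"
    using f(3)[of 0 2] f(3)[of 2 1] by auto
  ultimately show "\<exists>i j l. i < j \<and> j < l \<and> l < length p \<and> p ! i < p ! l \<and> p ! l < p ! j"
    by blast
next
  assume "\<exists>i j l. i < j \<and> j < l \<and> l < length p \<and> p ! i < p ! l \<and> p ! l < p ! j"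
  then obtain i j l where "i < j" "j < l" "l < length p" "p ! i < p ! l" "p ! l < p ! j" by blast
  then show "contains_pattern p [1, 3, 2]"
    unfolding contains_pattern_def
    by (intro exI[of _ "\<lambda>a. [i, j, l] ! a"])
      (auto simp: strict_mono_on_def numeral_3_eq_3 lessThan_Suc All_less_Suc)
qed

lemma contains_pattern_231_iff:
  "contains_pattern p [2, 3, 1] \<longleftrightarrow>
     (\<exists>i j l. i < j \<and> j < l \<and> l < length p \<and> p ! l < p ! i \<and> p ! i < p ! j)"
proof
  assume "contains_pattern p [2, 3, 1]"
  then obtain f where f: "strict_mono_on {..<3::nat} f" "f ` {..<3} \<subseteq> {..<length p}"
    "\<And>a b. a < 3 \<Longrightarrow> b < 3 \<Longrightarrow> p ! f a < p ! f b \<longleftrightarrow> [2, 3, 1::nat] ! a < [2, 3, 1] ! b"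
    by (auto simp: contains_pattern_def numeral_3_eq_3)
  have "f 0 < f 1" "f 1 < f 2" "f 2 < length p"
    using f(1,2) by (auto simp: strict_mono_on_def image_subset_iff)
  moreover have "p ! f 2 < p ! f 0" "p ! f 0 < p ! f 1"
    using f(3)[of 2 0] f(3)[of 0 1] by auto
  ultimately show "\<exists>i j l. i < j \<and> j < l \<and> l < length p \<and> p ! l < p ! i \<and> p ! i < p ! j"
    by blast
next
  assume "\<exists>i j l. i < j \<and> j < l \<and> l < length p \<and> p ! l < p ! i \<and> p ! i < p ! j"
  then obtain i j l where "i < j" "j < l" "l < length p" "p ! l < p ! i" "p ! i < p ! j" by blast
  then show "contains_pattern p [2, 3, 1]"
    unfolding contains_pattern_def
    by (intro exI[of _ "\<lambda>a. [i, j, l] ! a"])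
      (auto simp: strict_mono_on_def numeral_3_eq_3 lessThan_Suc All_less_Suc)
qed

section \<open>Valleys: decreasing words followed by increasing ones\<close>

lemma nth_decreasing_prefix:
  fixes L R :: "nat list"
  assumes "sorted_wrt (>) L" "i < j" "j < length L"
  shows "(L @ R) ! j < (L @ R) ! i"
  using assms by (auto simp: nth_append sorted_wrt_iff_nth_less)

lemma nth_increasing_suffix:
  fixes L R :: "nat list"
  assumes "sorted_wrt (<) R" "length L \<le> i" "i < j" "j < length (L @ R)"
  shows "(L @ R) ! i < (L @ R) ! j"
  using assms by (auto simp: nth_append sorted_wrt_iff_nth_less)

lemma valley_avoids:
  assumes "sorted_wrt (>) L" "sorted_wrt (<) R"
  shows "avoids (L @ R) [1, 3, 2]" "avoids (L @ R) [2, 3, 1]"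
proof -
  have no_peak: False
    if "i < j" "j < l" "l < length (L @ R)"
      "(L @ R) ! i < (L @ R) ! j" "(L @ R) ! l < (L @ R) ! j" for i j l
    using that nth_decreasing_prefix[OF assms(1), of i j R] nth_increasing_suffix[OF assms(2), of L j l]
    by (cases "j < length L") auto
  show "avoids (L @ R) [1, 3, 2]"
    unfolding avoids_def contains_pattern_132_iff using no_peak by (meson less_trans)
  show "avoids (L @ R) [2, 3, 1]"
    unfolding avoids_def contains_pattern_231_iff using no_peak by (meson less_trans)
qed

text \<open>
  The converse: a descent failing to the left of \<open>1\<close> gives a \<open>231\<close> whose last entry is that \<open>1\<close>,
  an ascent failing to its right gives a \<open>132\<close> whose first entry is that \<open>1\<close>.
\<close>

lemma avoiders_valley:
  assumes p: "is_perm (L @ 1 # R)"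
    and "avoids (L @ 1 # R) [1, 3, 2]" "avoids (L @ 1 # R) [2, 3, 1]"
  shows "sorted_wrt (>) L" "sorted_wrt (<) (1 # R)"
proof -
  let ?p = "L @ 1 # R"
  have dist: "distinct ?p" and gt: "\<And>x. x \<in> set L \<union> set R \<Longrightarrow> 1 < x"
    using p by (auto simp: is_perm_iff set_eq_iff) (metis Suc_lessI le_neq_implies_less)+
  have "L ! j < L ! i" if "i < j" "j < length L" for i j
  proof (rule ccontr)
    assume "\<not> L ! j < L ! i"
    then have less: "L ! i < L ! j"
      using that dist by (auto simp: nth_eq_iff_index_eq not_less le_less)
    have "1 < L ! i" using gt that by auto
    then have "contains_pattern ?p [2, 3, 1]"
      unfolding contains_pattern_231_iff
      using that less by (intro exI[of _ i] exI[of _ j] exI[of _ "length L"]) (auto simp: nth_append)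
    then show False using assms by (simp add: avoids_def)
  qed
  then show "sorted_wrt (>) L" by (simp add: sorted_wrt_iff_nth_less)
  have "R ! i < R ! j" if "i < j" "j < length R" for i j
  proof (rule ccontr)
    assume "\<not> R ! i < R ! j"
    then have less: "R ! j < R ! i"
      using that dist by (auto simp: nth_eq_iff_index_eq not_less le_less)
    have "1 < R ! j" using gt that by auto
    then have "contains_pattern ?p [1, 3, 2]"
      unfolding contains_pattern_132_iff
      using that less
      by (intro exI[of _ "length L"] exI[of _ "length L + Suc i"] exI[of _ "length L + Suc j"])
        (auto simp: nth_append)
    then show False using assms by (simp add: avoids_def)
  qed
  then have "sorted_wrt (<) R" by (simp add: sorted_wrt_iff_nth_less)
  then show "sorted_wrt (<) (1 # R)" using gt by simp
qed

text \<open>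
  The pairs of entries (rather than positions) forming inversions are exactly the pairs
  \<open>(x, y)\<close> with \<open>x \<in> set L\<close> and \<open>1 \<le> y < x\<close>.
\<close>

lemma card_inversions_valley:
  assumes p: "is_perm (L @ R)" and L: "sorted_wrt (>) L" and R: "sorted_wrt (<) R"
  shows "card (inversions (L @ R)) = (\<Sum>x\<in>set L. x - 1)"
proof -
  let ?p = "L @ R"
  let ?f = "\<lambda>(i, j). (?p ! i, ?p ! j)"
  have dist: "distinct ?p" and set: "set ?p = {1..length ?p}"
    using p by (auto simp: is_perm_iff)
  have inj: "inj_on ?f (inversions ?p)"
    using dist by (auto simp: inj_on_def inversions_def nth_eq_iff_index_eq simp del: length_append)
  have "?f ` inversions ?p = (SIGMA x:set L. {1..<x})"
  proof (intro equalityI subsetI)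
    fix z assume "z \<in> ?f ` inversions ?p"
    then obtain i j where ij: "i < j" "j < length ?p" "?p ! j < ?p ! i" "z = (?p ! i, ?p ! j)"
      by (auto simp: inversions_def)
    have "i < length L"
      using nth_increasing_suffix[OF R, of L i j] ij by (meson not_le less_asym)
    then have "?p ! i \<in> set L" by (simp add: nth_append)
    moreover have "1 \<le> ?p ! j" using nth_mem[OF ij(2)] unfolding set by simp
    ultimately show "z \<in> (SIGMA x:set L. {1..<x})" using ij by simp
  next
    fix z assume "z \<in> (SIGMA x:set L. {1..<x})"
    then obtain x y where xy: "z = (x, y)" "x \<in> set L" "1 \<le> y" "y < x" by auto
    obtain i where i: "i < length L" "L ! i = x" using xy by (auto simp: in_set_conv_nth)
    have "x \<le> length ?p" using xy set by (metis UnCI atLeastAtMost_iff set_append)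
    then have "y \<in> set ?p" using xy unfolding set by simp
    then obtain j where j: "j < length ?p" "?p ! j = y" by (auto simp only: in_set_conv_nth)
    have ix: "?p ! i = x" using i by (simp add: nth_append)
    have "i < j"
    proof (rule ccontr)
      assume "\<not> i < j"
      moreover have "i \<noteq> j" using ix j xy by auto
      ultimately have "?p ! i < ?p ! j" using nth_decreasing_prefix[OF L, of j i R] i by simp
      then show False using ix j xy by simp
    qed
    then have "(i, j) \<in> inversions ?p" using ix j xy by (simp add: inversions_def)
    then show "z \<in> ?f ` inversions ?p" using ix j xy by force
  qed
  then have "card (inversions ?p) = card (SIGMA x:set L. {1..<x})"
    using card_image[OF inj] by simp
  then show ?thesis by simp
qed

section \<open>Indecomposability and the position of the maximum\<close>

text \<open>
  The entries of a proper first summand are at most its length, which is less than \<open>length p\<close>.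
\<close>

lemma indecomposable_if_hd_max:
  assumes "is_perm p" "p \<noteq> []" "hd p = length p"
  shows "indecomposable p"
proof -
  have False if rt: "is_perm r" "r \<noteq> []" "t \<noteq> []" "p = perm_sum r t" for r t
  proof -
    have "hd r \<le> length r" using rt(1,2) hd_in_set[OF rt(2)] by (auto simp: is_perm_iff)
    also have "\<dots> < length p" using rt by (simp add: perm_sum_def)
    finally show False using rt assms(3) by (simp add: perm_sum_def)
  qed
  then show ?thesis using assms(1,2) by (auto simp: indecomposable_def decomposable_def)
qed

lemma decomposable_if_last_max:
  assumes p: "is_perm p" and "1 < length p" and last: "last p = length p"
  shows "decomposable p"
proof -
  have ne: "p \<noteq> []" using assms(2) by auto
  then have eq: "p = butlast p @ [length p]" using last by (metis append_butlast_last_id)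
  have "distinct (butlast p @ [length p])" "set (butlast p @ [length p]) = {1..length p}"
    using p eq by (auto simp: is_perm_iff simp del: set_append)
  then have "distinct (butlast p)" "set (butlast p) = {1..length p} - {length p}" by auto
  moreover have "{1..length p} - {length p} = {1..length p - 1}" by auto
  ultimately have "is_perm (butlast p)" by (simp add: is_perm_iff)
  moreover have "is_perm [1]" by (simp add: is_perm_iff)
  moreover have "butlast p \<noteq> []"
    using assms(2) by (metis length_butlast length_0_conv zero_less_diff less_irrefl)
  moreover have "p = perm_sum (butlast p) [1]" using eq ne by (simp add: perm_sum_def)
  ultimately show ?thesis unfolding decomposable_def by blast
qed

text \<open>
  For length \<open>1\<close> the maximum is last without splitting off, but then it is also first.
\<close>

lemma hd_max_if_indecomposable_valley:
  assumes indec: "indecomposable (L @ R)" and L: "sorted_wrt (>) L" and R: "sorted_wrt (<) R"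
  shows "hd (L @ R) = length (L @ R)"
proof -
  let ?p = "L @ R" and ?n = "length (L @ R)"
  have p: "is_perm ?p" and ne: "?p \<noteq> []" using indec by (auto simp: indecomposable_def)
  have set: "set ?p = {1..?n}" using p by (simp add: is_perm_iff)
  have n: "0 < ?n" using ne by blast
  then have "?n \<in> set ?p"
    by (simp only: set atLeastAtMost_iff Suc_le_eq One_nat_def order_refl simp_thms)
  then obtain i where i: "i < ?n" "?p ! i = ?n" by (auto simp only: in_set_conv_nth)
  have le: "?p ! j \<le> ?n" if "j < ?n" for j using nth_mem[OF that] unfolding set by simp
  have "i = 0"
  proof (cases "i < length L")
    case True
    then show ?thesis using nth_decreasing_prefix[OF L, of 0 i R] le[of 0] i by fastforce
  next
    case False
    have "i = ?n - 1"
    proof (rule ccontr)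
      assume "i \<noteq> ?n - 1"
      then have "i < ?n - 1" using i by linarith
      then show False
        using nth_increasing_suffix[OF R, of L i "?n - 1"] False le[of "?n - 1"] i n by linarith
    qed
    then have "last ?p = ?n" using i last_conv_nth[OF ne] by simp
    then have "\<not> 1 < ?n"
      using decomposable_if_last_max[OF p] indec by (auto simp: indecomposable_def)
    then show ?thesis using i by linarith
  qed
  then show ?thesis using i ne by (simp add: hd_conv_nth)
qed

section \<open>Indecomposable valleys and their sets of left entries\<close>

text \<open>
  The valley that starts with its maximal entry and has \<open>D\<close> as the set of entries to the left
  of \<open>1\<close>.  For empty \<open>D\<close> this is the permutation of length \<open>1\<close>, whence the \<open>insert 1\<close>.
\<close>

definition valley_word :: "nat set \<Rightarrow> nat list" where
  "valley_word D =
     rev (sorted_list_of_set D) @ sorted_list_of_set ({1..Max (insert 1 D)} - D)"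

text \<open>
  The finite sets \<open>D\<close> of entries \<open>\<ge> 2\<close> whose valley has \<open>k\<close> inversions.
\<close>

definition left_sets :: "nat \<Rightarrow> nat set set" where
  "left_sets k = {D. finite D \<and> D \<subseteq> {2..} \<and> (\<Sum>x\<in>D. x - 1) = k}"

lemma is_perm_valley_word:
  assumes "finite D" "D \<subseteq> {2..}"
  shows "is_perm (valley_word D)" "length (valley_word D) = Max (insert 1 D)"
proof -
  let ?n = "Max (insert 1 D)"
  have "x \<le> ?n" if "x \<in> D" for x using assms(1) that by simp
  then have D: "D \<subseteq> {1..?n}" using assms(2) by force
  have dist: "distinct (valley_word D)" using assms(1) by (auto simp: valley_word_def)
  have set: "set (valley_word D) = {1..?n}"
    using D assms(1) by (auto simp: valley_word_def)
  show len: "length (valley_word D) = ?n"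
    using distinct_card[OF dist] unfolding set by simp
  show "is_perm (valley_word D)" using dist set len by (simp add: is_perm_iff)
qed

lemma hd_valley_word:
  assumes "finite D" "D \<subseteq> {2..}"
  shows "hd (valley_word D) = Max (insert 1 D)"
proof (cases "D = {}")
  case True
  then show ?thesis by (simp add: valley_word_def)
next
  case False
  let ?L = "rev (sorted_list_of_set D)"
  have L: "sorted_wrt (>) ?L" "set ?L = D"
    using assms by (simp_all add: sorted_wrt_rev)
  then obtain x xs where x: "?L = x # xs" using False by (cases ?L) auto
  then have "Max D = x" using L assms by (intro Max_eqI) auto
  moreover have "hd (valley_word D) = x" using x by (simp add: valley_word_def)
  moreover have "Max (insert 1 D) = max 1 (Max D)" using assms(1) False by simp
  moreover have "1 \<le> Max D"
  proof -
    have "Max D \<in> D" using assms(1) False by simp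
    then show ?thesis using assms(2) by auto
  qed
  ultimately show ?thesis by simp
qed

lemma sorted_wrt_sorted_list_of_set:
  shows "sorted_wrt (>) (rev (sorted_list_of_set D))"
    and "sorted_wrt (<) (sorted_list_of_set (E :: nat set))"
  by (simp_all add: sorted_wrt_rev)

lemma valley_word_in_avoiders:
  assumes "D \<in> left_sets k"
  shows "valley_word D \<in> indecomposable_avoiders k {[1, 3, 2], [2, 3, 1]}"
proof -
  have D: "finite D" "D \<subseteq> {2..}" and k: "(\<Sum>x\<in>D. x - 1) = k"
    using assms by (auto simp: left_sets_def)
  note perm = is_perm_valley_word[OF D]
  have "0 < length (valley_word D)" unfolding perm(2) using D(1) by (simp add: Max_gr_iff)
  then have "indecomposable (valley_word D)"
    using perm hd_valley_word[OF D] by (intro indecomposable_if_hd_max) auto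
  moreover have "avoids (valley_word D) [1, 3, 2]" "avoids (valley_word D) [2, 3, 1]"
    unfolding valley_word_def by (intro valley_avoids sorted_wrt_sorted_list_of_set)+
  moreover have "card (inversions (valley_word D)) = k"
    using card_inversions_valley[OF _ sorted_wrt_sorted_list_of_set] perm(1) D(1) k
    by (simp add: valley_word_def)
  ultimately show ?thesis by (simp add: indecomposable_avoiders_def)
qed

text \<open>
  \<open>D\<close> can be read off from its valley as the set of the entries to the left of \<open>1\<close>.
\<close>

lemma set_takeWhile_valley_word:
  assumes "finite D" "D \<subseteq> {2..}"
  shows "set (takeWhile (\<lambda>x. x \<noteq> 1) (valley_word D)) = D"
proof -
  let ?R = "sorted_list_of_set ({1..Max (insert 1 D)} - D)"
  have mem: "1 \<in> set ?R" using assms by auto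
  then obtain y ys where R: "?R = y # ys" by (cases ?R) auto
  have "sorted_wrt (<) ?R" by simp
  then have "y \<le> 1" using mem unfolding R by auto
  moreover have "y \<in> set ?R" unfolding R by simp
  ultimately have "y = 1" by simp
  moreover have "x \<noteq> 1" if "x \<in> set (rev (sorted_list_of_set D))" for x
    using that assms by auto
  ultimately have "takeWhile (\<lambda>x. x \<noteq> 1) (valley_word D) = rev (sorted_list_of_set D)"
    unfolding valley_word_def R by (subst takeWhile_append2) auto
  then show ?thesis using assms(1) by simp
qed

lemma avoider_is_valley_word:
  assumes "p \<in> indecomposable_avoiders k {[1, 3, 2], [2, 3, 1]}"
  shows "p \<in> valley_word ` left_sets k"
proof -
  have indec: "indecomposable p" and k: "card (inversions p) = k"
    and av: "avoids p [1, 3, 2]" "avoids p [2, 3, 1]"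
    using assms by (auto simp: indecomposable_avoiders_def)
  have perm: "is_perm p" and "p \<noteq> []" using indec by (auto simp: indecomposable_def)
  then have "1 \<in> set p" by (cases p) (auto simp: is_perm_iff)
  then obtain L R where p: "p = L @ 1 # R" by (meson split_list)
  have sorted: "sorted_wrt (>) L" "sorted_wrt (<) (1 # R)"
    using avoiders_valley perm av unfolding p by blast+
  let ?n = "length p"
  have hd: "hd p = ?n" using hd_max_if_indecomposable_valley[OF _ sorted] indec unfolding p by blast
  have dist: "distinct p" and set: "set p = {1..?n}" using perm by (auto simp: is_perm_iff)
  have "2 \<le> x" if "x \<in> set L" for x
  proof -
    have "x \<in> set p" "x \<noteq> 1" using that dist by (auto simp: p)
    then show ?thesis unfolding set by simp
  qed
  moreover have "card (inversions p) = (\<Sum>x\<in>set L. x - 1)"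
    using card_inversions_valley[OF _ sorted] perm unfolding p by blast
  ultimately have "set L \<in> left_sets k" using k by (auto simp: left_sets_def)
  moreover have "p = valley_word (set L)"
  proof -
    have "rev L = sorted_list_of_set (set L)"
      using sorted(1) by (intro strict_sorted_equal) (auto simp: sorted_wrt_rev)
    then have L: "L = rev (sorted_list_of_set (set L))" by (metis rev_rev_ident)
    have "?n \<in> insert 1 (set L)" using hd unfolding p by (cases L) auto
    moreover have "x \<le> ?n" if "x \<in> insert 1 (set L)" for x
    proof -
      have "x \<in> set p" using that p by auto
      then show ?thesis unfolding set by simp
    qed
    ultimately have "Max (insert 1 (set L)) = ?n" by (intro Max_eqI) auto
    then have "{1..Max (insert 1 (set L))} - set L = set p - set L" using set by simp
    also have "\<dots> = set (1 # R)" using dist by (auto simp: p)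
    finally have right: "{1..Max (insert 1 (set L))} - set L = set (1 # R)" .
    have "1 # R = sorted_list_of_set (set (1 # R))"
      by (rule strict_sorted_equal[OF strict_sorted_list_of_set sorted(2)])
        (simp only: set_sorted_list_of_set List.finite_set)
    then show ?thesis using L p right unfolding valley_word_def by metis
  qed
  ultimately show ?thesis by blast
qed

lemma bij_betw_valley_word:
  "bij_betw valley_word (left_sets k) (indecomposable_avoiders k {[1, 3, 2], [2, 3, 1]})"
proof (rule bij_betw_imageI)
  show "inj_on valley_word (left_sets k)"
    by (rule inj_on_inverseI[of _ "\<lambda>p. set (takeWhile (\<lambda>x. x \<noteq> 1) p)"])
      (simp add: left_sets_def set_takeWhile_valley_word del: One_nat_def)
  show "valley_word ` left_sets k = indecomposable_avoiders k {[1, 3, 2], [2, 3, 1]}"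
    using valley_word_in_avoiders avoider_is_valley_word by blast
qed

section \<open>Partitions into distinct parts\<close>

lemma mset_set_set_mset_distinct:
  assumes "distinct_parts N"
  shows "mset_set (set_mset N) = N"
proof (rule multiset_eqI)
  fix x
  have "count N x \<le> 1" using assms by (simp add: distinct_parts_def)
  then show "count (mset_set (set_mset N)) x = count N x"
    by (cases "x \<in># N") (auto simp: count_mset_set' count_eq_zero_iff le_Suc_eq)
qed

lemma bij_betw_distinct_partitions:
  "bij_betw (\<lambda>N. Suc ` set_mset N) {N \<in> partitions k. distinct_parts N} (left_sets k)"
proof (rule bij_betw_byWitness[where f' = "\<lambda>D. mset_set ((\<lambda>x. x - 1) ` D)"])
  show "\<forall>N\<in>{N \<in> partitions k. distinct_parts N}.
      mset_set ((\<lambda>x. x - 1) ` Suc ` set_mset N) = N"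
    by (simp add: image_image mset_set_set_mset_distinct)
  have shift: "Suc ` (\<lambda>x. x - 1) ` D = D" "inj_on (\<lambda>x. x - 1) D" "0 \<notin> (\<lambda>x. x - 1) ` D"
    if "D \<subseteq> {2..}" for D :: "nat set"
  proof -
    have suc: "Suc (x - 1) = x" if "x \<in> D" for x
      using that \<open>D \<subseteq> {2..}\<close> by auto
    then show "Suc ` (\<lambda>x. x - 1) ` D = D" by (simp add: image_image)
    show "inj_on (\<lambda>x. x - 1) D" by (rule inj_on_inverseI[of _ Suc]) (rule suc)
    show "0 \<notin> (\<lambda>x. x - 1) ` D" using that by auto
  qed
  show "\<forall>D\<in>left_sets k. Suc ` set_mset (mset_set ((\<lambda>x. x - 1) ` D)) = D"
    using shift(1) by (simp add: left_sets_def)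
  have "Suc ` set_mset N \<in> left_sets k" if "N \<in> partitions k" "distinct_parts N" for N
  proof -
    have N: "0 \<notin># N" "sum_mset N = k" using that(1) by (auto simp: partitions_def)
    have "(\<Sum>x\<in>Suc ` set_mset N. x - 1) = (\<Sum>x\<in>set_mset N. x)"
      by (simp add: sum.reindex)
    also have "\<dots> = sum_mset (mset_set (set_mset N))" by (simp add: sum_unfold_sum_mset)
    also have "\<dots> = k" using N(2) mset_set_set_mset_distinct[OF that(2)] by simp
    finally have "(\<Sum>x\<in>Suc ` set_mset N. x - 1) = k" .
    moreover have "2 \<le> Suc x" if "x \<in># N" for x using that N(1) by (cases x) auto
    ultimately show ?thesis by (auto simp: left_sets_def)
  qed
  then show "(\<lambda>N. Suc ` set_mset N) ` {N \<in> partitions k. distinct_parts N} \<subseteq> left_sets k"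
    by blast
  have "mset_set ((\<lambda>x. x - 1) ` D) \<in> partitions k" if "D \<in> left_sets k" for D
  proof -
    have D: "finite D" "D \<subseteq> {2..}" "(\<Sum>x\<in>D. x - 1) = k" using that by (auto simp: left_sets_def)
    have "sum_mset (mset_set ((\<lambda>x. x - 1) ` D)) = (\<Sum>x\<in>(\<lambda>x. x - 1) ` D. x)"
      by (simp add: sum_unfold_sum_mset)
    also have "\<dots> = k" using D(3) shift(2)[OF D(2)] by (simp add: sum.reindex)
    finally show ?thesis using D(1) shift(3)[OF D(2)] by (simp add: partitions_def)
  qed
  moreover have "distinct_parts (mset_set A)" for A
    by (simp add: distinct_parts_def count_mset_set')
  ultimately show "(\<lambda>D. mset_set ((\<lambda>x. x - 1) ` D)) ` left_sets k
      \<subseteq> {N \<in> partitions k. distinct_parts N}"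
    by blast
qed

theorem theorem18:
  fixes k :: nat
  shows "card (indecomposable_avoiders k {[1, 3, 2], [2, 3, 1]}) =
         card {N \<in> partitions k. distinct_parts N}"
  using bij_betw_same_card[OF bij_betw_trans[OF bij_betw_distinct_partitions bij_betw_valley_word]]
  by simp

end
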